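(* With the notation of the context, for every $a\in[0,\tfrac12)$, $$\cot R(a)=\frac{\dot z_a\bigl(s_1(a)\bigr)}{z_a\bigl(s_1(a)\bigr)}=-\,\frac{a\sin\bigl(2s_1(a)\bigr)}{\tfrac12+a\cos\bigl(2s_1(a)\bigr)} .$$ In particular $R$ is an elementary function of $a$ and of the single scalar $s_1(a)$.
   Context: For $a\in[0,\tfrac12)$ put $\lambda_a(s)=\tfrac12-a\cos 2s$, $z_a(s)=(\tfrac12+a\cos2s)^{1/2}$, $c(a)=(\tfrac14-a^2)^{1/2}$, $\omega(a,t)=\dfrac{c(a)}{z_a(t)\lambda_a(t)}$, $\beta(a,s)=\int_0^s\omega(a,t)\,dt$, $x_a=\lambda_a^{1/2}\cos\beta(a,\cdot)$, $y_a=\lambda_a^{1/2}\sin\beta(a,\cdot)$, and $G_a=y_a\dot z_a-z_a\dot y_a$, where a dot denotes $d/ds$. $G_a$ has exactly one zero in $(0,\tfrac\pi2]$, denoted $s_1(a)$, and $R(a)=\arccos x_a(s_1(a))\in(0,\pi)$. (Geometrically, $(s,\theta)\mapsto(x_a,y_a,z_a\cos\theta,z_a\sin\theta)$ restricted to $[-s_1(a),s_1(a)]\times\mathbb{S}^1$ is a free boundary minimal annulus in the geodesic ball of $\mathbb{S}^3$ of radius $R(a)$ centred at $(1,0,0,0)$.) *)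

theory Defs
  imports "HOL-Analysis.Analysis"
begin

definition lam :: "real \<Rightarrow> real \<Rightarrow> real" where
  "lam a s = 1/2 - a * cos (2 * s)"

definition zfun :: "real \<Rightarrow> real \<Rightarrow> real" where
  "zfun a s = sqrt (1/2 + a * cos (2 * s))"

definition cpar :: "real \<Rightarrow> real" where
  "cpar a = sqrt (1/4 - a\<^sup>2)"

definition omega :: "real \<Rightarrow> real \<Rightarrow> real" where
  "omega a t = cpar a / (zfun a t * lam a t)"

(* The oriented integral, so that beta a is the primitive of omega a vanishing at 0
   also for negative s. *)
definition beta :: "real \<Rightarrow> real \<Rightarrow> real" where
  "beta a s = (LBINT t=0..s. omega a t)"

definition xfun :: "real \<Rightarrow> real \<Rightarrow> real" where
  "xfun a s = sqrt (lam a s) * cos (beta a s)"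

definition yfun :: "real \<Rightarrow> real \<Rightarrow> real" where
  "yfun a s = sqrt (lam a s) * sin (beta a s)"

definition Gfun :: "real \<Rightarrow> real \<Rightarrow> real" where
  "Gfun a s = yfun a s * deriv (zfun a) s - zfun a s * deriv (yfun a) s"

(* For 0 \<le> a < 1/2 there is exactly one such zero; outside that range the value is not used. *)
definition s1 :: "real \<Rightarrow> real" where
  "s1 a = (THE s. s \<in> {0<..pi/2} \<and> Gfun a s = 0)"

definition Rad :: "real \<Rightarrow> real" where
  "Rad a = arccos (xfun a (s1 a))"

(* Elementary functions of two real variables on a domain D: built from constants and the two
   coordinates by arithmetic, roots, exp, ln, and the trigonometric functions and their inverses.
   The side conditions keep every operation inside its true domain on D, so that the totalised
   values of HOL (such as x / 0 = 0) cannot be exploited. *)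
inductive elementary_on :: "(real \<times> real) set \<Rightarrow> (real \<times> real \<Rightarrow> real) \<Rightarrow> bool"
  for D :: "(real \<times> real) set"
where
  const: "elementary_on D (\<lambda>p. k)"
| fst: "elementary_on D (\<lambda>p. fst p)"
| snd: "elementary_on D (\<lambda>p. snd p)"
| add: "elementary_on D f \<Longrightarrow> elementary_on D g \<Longrightarrow> elementary_on D (\<lambda>p. f p + g p)"
| diff: "elementary_on D f \<Longrightarrow> elementary_on D g \<Longrightarrow> elementary_on D (\<lambda>p. f p - g p)"
| mult: "elementary_on D f \<Longrightarrow> elementary_on D g \<Longrightarrow> elementary_on D (\<lambda>p. f p * g p)"
| divide: "elementary_on D f \<Longrightarrow> elementary_on D g \<Longrightarrow> (\<And>p. p \<in> D \<Longrightarrow> g p \<noteq> 0)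
    \<Longrightarrow> elementary_on D (\<lambda>p. f p / g p)"
| root: "elementary_on D f \<Longrightarrow> n > 0 \<Longrightarrow> (\<And>p. p \<in> D \<Longrightarrow> f p \<ge> 0)
    \<Longrightarrow> elementary_on D (\<lambda>p. root n (f p))"
| exp: "elementary_on D f \<Longrightarrow> elementary_on D (\<lambda>p. exp (f p))"
| ln: "elementary_on D f \<Longrightarrow> (\<And>p. p \<in> D \<Longrightarrow> f p > 0) \<Longrightarrow> elementary_on D (\<lambda>p. ln (f p))"
| sin: "elementary_on D f \<Longrightarrow> elementary_on D (\<lambda>p. sin (f p))"
| cos: "elementary_on D f \<Longrightarrow> elementary_on D (\<lambda>p. cos (f p))"
| arcsin: "elementary_on D f \<Longrightarrow> (\<And>p. p \<in> D \<Longrightarrow> \<bar>f p\<bar> \<le> 1)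
    \<Longrightarrow> elementary_on D (\<lambda>p. arcsin (f p))"
| arccos: "elementary_on D f \<Longrightarrow> (\<And>p. p \<in> D \<Longrightarrow> \<bar>f p\<bar> \<le> 1)
    \<Longrightarrow> elementary_on D (\<lambda>p. arccos (f p))"
| arctan: "elementary_on D f \<Longrightarrow> elementary_on D (\<lambda>p. arctan (f p))"

end

theory Submission
  imports Defs
begin

text \<open>
  Write \<open>S = a sin 2s\<close>, \<open>c = cpar a\<close>, and \<open>x, y, z, \<lambda>, \<beta>, G\<close> for the functions of the
  definitions. The profile \<open>(x, y, z)\<close> is a unit speed curve on the unit sphere, and the
  proof has two halves.

  The first half shows that the zero \<open>s1 a\<close> exists and is unique, so that the definite
  description denotes it. The surface generated by the profile is minimal in the
  3-sphere, so its coordinate \<open>y\<close> is a Laplace eigenfunction, \<open>y'' + (z'/z) y' = - 2 y\<close>.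
  Inserting this into \<open>(zG)' = (y z z' - z\<^sup>2 y')'\<close> leaves \<open>y ((z z')' + 2 z\<^sup>2)\<close>, and since
  \<open>z\<^sup>2 = 1/2 + a cos 2s\<close> the bracket equals 1. Hence \<open>(zG)' = y\<close>
  (\<open>zfun_times_Gfun_has_derivative\<close>, checked there directly from the closed form
  \<open>zG = - (c z cos \<beta> + S sin \<beta>) / sqrt \<lambda>\<close> of \<open>zfun_times_Gfun\<close>). As
  \<open>y = sqrt \<lambda> sin \<beta>\<close>, the function \<open>zG\<close> is strictly increasing as long as
  \<open>0 < \<beta> < \<pi>\<close>. It is negative at \<open>0\<close>, and at \<open>\<pi>/2\<close>, where \<open>S = 0\<close>, its sign is that of
  \<open>- cos \<beta>\<close>. Everything therefore reduces to \<open>\<pi>/2 \<le> \<beta>(\<pi>/2) \<le> \<pi>\<close>. This follows from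
  \<open>c/\<lambda> \<le> \<omega> \<le> 1 + c/\<lambda>\<close> (\<open>omega_bounds\<close>), because \<open>c/\<lambda>\<close> is a Poisson kernel in \<open>2s\<close>,
  with an explicit primitive that grows by exactly \<open>\<pi>/2\<close> on \<open>[0, \<pi>/2]\<close>.

  The second half (\<open>cot_Rad\<close>) is algebra at the zero. With \<open>m = z'/z = - S/z\<^sup>2\<close>, the
  condition \<open>G = 0\<close> says \<open>y' = m y\<close>, so \<open>x x' = - (y y' + z z') = - m (1 - x\<^sup>2)\<close>; together
  with the unit speed relation \<open>x'\<^sup>2 + m\<^sup>2 (1 - x\<^sup>2) = 1\<close> this yields
  \<open>x\<^sup>2 = m\<^sup>2 (1 - x\<^sup>2)\<close>, that is \<open>cot\<^sup>2 R = m\<^sup>2\<close>. Both \<open>x\<close> and \<open>m\<close> are nonpositive there,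
  so \<open>cot R = m\<close>. Finally \<open>R = \<pi>/2 - arctan (cot R)\<close> on \<open>(0, \<pi>)\<close>, which is elementary in
  \<open>a\<close> and \<open>s1 a\<close>.
\<close>

section \<open>The profile functions\<close>

lemma abs_mult_cos_le:
  fixes a :: real
  assumes "0 \<le> a"
  shows "\<bar>a * cos u\<bar> \<le> a"
  using assms by (simp add: abs_mult mult_left_le)

context
  fixes a :: real
  assumes a_nonneg: "0 \<le> a" and a_less: "a < 1/2"
begin

lemma lam_pos: "0 < lam a s"
  using abs_mult_cos_le[OF a_nonneg, of "2 * s"] a_less unfolding lam_def by linarith

lemma half_minus_le_zfun_sq: "1/2 - a \<le> 1/2 + a * cos (2 * s)"
  using abs_mult_cos_le[OF a_nonneg, of "2 * s"] by linarith

lemma zfun_arg_pos: "0 < 1/2 + a * cos (2 * s)"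
  using half_minus_le_zfun_sq[of s] a_less by linarith

lemma zfun_pos: "0 < zfun a s"
  using zfun_arg_pos unfolding zfun_def by simp

lemma zfun_sq: "(zfun a s)\<^sup>2 = 1/2 + a * cos (2 * s)"
  using zfun_arg_pos[of s] unfolding zfun_def by simp

lemma lam_plus_zfun_sq: "lam a s + (zfun a s)\<^sup>2 = 1"
  unfolding zfun_sq lam_def by simp

lemma zfun_le_1: "zfun a s \<le> 1"
proof (rule power2_le_imp_le)
  show "(zfun a s)\<^sup>2 \<le> 1\<^sup>2"
    using lam_plus_zfun_sq[of s] lam_pos[of s] by simp
qed simp

lemma cpar_pos: "0 < cpar a"
proof -
  have "a\<^sup>2 < (1/2)\<^sup>2"
    using a_nonneg a_less by (intro power_strict_mono) auto
  then show ?thesis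
    unfolding cpar_def by (simp add: power2_eq_square)
qed

lemma cpar_sq: "(cpar a)\<^sup>2 = 1/4 - a\<^sup>2"
  using cpar_pos unfolding cpar_def by simp

text \<open>
  Divided by \<open>\<lambda> z\<^sup>2\<close>, this is the unit speed relation of the profile curve: its squared
  speed is \<open>S\<^sup>2/\<lambda> + \<lambda> \<omega>\<^sup>2 + S\<^sup>2/z\<^sup>2 = (S\<^sup>2 + c\<^sup>2) / (\<lambda> z\<^sup>2)\<close>.
\<close>

lemma lam_times_zfun_sq: "lam a s * (zfun a s)\<^sup>2 = (cpar a)\<^sup>2 + (a * sin (2 * s))\<^sup>2"
proof -
  have "lam a s * (zfun a s)\<^sup>2 = 1/4 - a\<^sup>2 * (cos (2 * s))\<^sup>2"
    unfolding lam_def zfun_sq by (simp add: algebra_simps power2_eq_square)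
  also have "\<dots> = 1/4 - a\<^sup>2 * (1 - (sin (2 * s))\<^sup>2)"
    by (simp only: cos_squared_eq)
  also have "\<dots> = (cpar a)\<^sup>2 + (a * sin (2 * s))\<^sup>2"
    unfolding cpar_sq by (simp add: algebra_simps power_mult_distrib)
  finally show ?thesis .
qed

lemma cpar_le_zfun: "cpar a \<le> zfun a s"
proof -
  have "(cpar a)\<^sup>2 = (1/2 - a) * (1/2 + a)"
    unfolding cpar_sq by (simp add: algebra_simps power2_eq_square)
  also have "\<dots> \<le> (1/2 - a) * 1"
    using a_less by (intro mult_left_mono) auto
  also have "\<dots> \<le> (zfun a s)\<^sup>2"
    using half_minus_le_zfun_sq[of s] unfolding zfun_sq by simp
  finally show ?thesis
    using zfun_pos[of s] power2_le_imp_le by fastforce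
qed

lemma zfun_has_derivative:
  "(zfun a has_real_derivative - (a * sin (2 * s)) / zfun a s) (at s)"
  unfolding zfun_def[abs_def]
  using zfun_arg_pos[of s]
  by (auto intro!: derivative_eq_intros simp: field_simps)

lemma sqrt_lam_has_derivative:
  "((\<lambda>s. sqrt (lam a s)) has_real_derivative (a * sin (2 * s)) / sqrt (lam a s)) (at s)"
  using lam_pos[of s] unfolding lam_def
  by (auto intro!: derivative_eq_intros simp: field_simps)

lemma omega_continuous: "continuous_on A (omega a)"
proof -
  have "continuous_on A (\<lambda>t. cpar a / (sqrt (1/2 + a * cos (2 * t)) * (1/2 - a * cos (2 * t))))"
    using zfun_pos lam_pos
    by (intro continuous_intros) (auto simp: zfun_def lam_def less_le)
  then show ?thesis
    unfolding omega_def[abs_def] zfun_def lam_def .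
qed

lemma beta_has_derivative: "(beta a has_real_derivative omega a s) (at s)"
proof -
  define r where "r = \<bar>s\<bar> + 1"
  have "((\<lambda>u. LBINT t=ereal 0..ereal u. omega a t) has_vector_derivative omega a s)
          (at s within {-r..r})"
    by (rule interval_integral_FTC2) (auto simp: r_def omega_continuous)
  moreover have "at s within {-r..r} = at s"
    by (rule at_within_interior) (auto simp: r_def)
  ultimately show ?thesis
    unfolding beta_def[abs_def] has_real_derivative_iff_has_vector_derivative
    by (simp add: zero_ereal_def)
qed

lemma beta_0: "beta a 0 = 0"
  unfolding beta_def by (simp add: zero_ereal_def[symmetric])

section \<open>The range of the angle\<close>

text \<open>
  With \<open>b = 2a / (1 + 2c)\<close> one has \<open>a = b / (1 + b\<^sup>2)\<close>, and \<open>c/\<lambda>\<close> becomes the Poisson kernel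
  \<open>(1 - b\<^sup>2) / (1 - 2 b cos 2s + b\<^sup>2)\<close>. Its primitive is \<open>s - Arg (1 - b exp (2 i s))\<close>, the
  function below. The more familiar primitive \<open>arctan (k tan s)\<close>,
  \<open>k = (1 + b) / (1 - b)\<close>, agrees with it on
  \<open>[0, \<pi>/2)\<close> but breaks down at \<open>\<pi>/2\<close>, exactly where the value is needed.
\<close>

lemma poisson_angle_has_derivative:
  "((\<lambda>s. s + arctan (2 * a * sin (2 * s) / (1 + 2 * cpar a - 2 * a * cos (2 * s))))
     has_real_derivative cpar a / lam a s) (at s)"
proof -
  define N where "N = (\<lambda>s. 2 * a * sin (2 * s))"
  define D where "D = (\<lambda>s. 1 + 2 * cpar a - 2 * a * cos (2 * s))"
  have D_pos: "0 < D s"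
    using abs_mult_cos_le[OF a_nonneg, of "2 * s"] a_less cpar_pos unfolding D_def by simp
  have dN: "(N has_real_derivative 4 * a * cos (2 * s)) (at s)"
    unfolding N_def by (auto intro!: derivative_eq_intros)
  have dD: "(D has_real_derivative 2 * N s) (at s)"
    unfolding D_def N_def by (auto intro!: derivative_eq_intros)
  have d: "((\<lambda>s. s + arctan (N s / D s)) has_real_derivative
      1 + inverse (1 + (N s / D s)\<^sup>2) * ((4 * a * cos (2 * s) * D s - N s * (2 * N s)) / (D s * D s)))
      (at s)"
    by (intro derivative_intros DERIV_chain2[OF DERIV_arctan] DERIV_divide dN dD)
       (use D_pos in auto)
  have "inverse (1 + (N s / D s)\<^sup>2) * ((4 * a * cos (2 * s) * D s - N s * (2 * N s)) / (D s * D s))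
      = (4 * a * cos (2 * s) * D s - 2 * (N s)\<^sup>2) / ((D s)\<^sup>2 + (N s)\<^sup>2)"
  proof -
    have "1 + (N s / D s)\<^sup>2 = ((D s)\<^sup>2 + (N s)\<^sup>2) / (D s)\<^sup>2"
      using D_pos by (simp add: power_divide add_divide_distrib)
    then show ?thesis
      using D_pos by (simp add: power2_eq_square)
  qed
  also have "\<dots> = (2 * cpar a - 2 * lam a s) / (2 * lam a s)"
  proof -
    define C where "C = cos (2 * s)"
    define c where "c = cpar a"
    have c2: "4 * a\<^sup>2 = 1 - 4 * c\<^sup>2"
      using cpar_sq unfolding c_def by simp
    have N2: "(N s)\<^sup>2 = 4 * a\<^sup>2 - 4 * a\<^sup>2 * C\<^sup>2"
      unfolding N_def C_def power_mult_distrib sin_squared_eq by (simp add: algebra_simps)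
    have D: "D s = 1 + 2 * c - 2 * a * C" and L: "2 * lam a s = 1 - 2 * a * C"
      unfolding D_def lam_def c_def C_def by simp_all
    have den: "(D s)\<^sup>2 + (N s)\<^sup>2 = 2 * (1 + 2 * c) * (2 * lam a s)"
      unfolding N2 L D using c2 by (simp add: algebra_simps power2_eq_square)
    have num: "4 * a * C * D s - 2 * (N s)\<^sup>2 = 2 * (1 + 2 * c) * (2 * c - 2 * lam a s)"
      unfolding N2 L D using c2 by (simp add: algebra_simps power2_eq_square)
    have "1 + 2 * c \<noteq> 0"
      using cpar_pos unfolding c_def by simp
    then show ?thesis
      unfolding den num[unfolded C_def] c_def by simp
  qed
  also have "\<dots> = cpar a / lam a s - 1"
    using lam_pos[of s] by (simp add: diff_divide_distrib)
  finally show ?thesis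
    using d unfolding N_def D_def by simp
qed

text \<open>
  The lower bound is \<open>z \<le> 1\<close>. For the upper bound \<open>\<lambda> + z\<^sup>2 = 1\<close> splits \<open>\<omega>\<close> as
  \<open>c/z + c z/\<lambda>\<close>. This separates the two ways in which \<open>\<omega>\<close> degenerates as \<open>a\<close> tends to
  \<open>1/2\<close>: \<open>c \<le> z\<close> controls the point \<open>s = \<pi>/2\<close> where \<open>z\<close> becomes small, and the Poisson
  kernel absorbs the concentration at \<open>s = 0\<close> where \<open>\<lambda>\<close> becomes small.
\<close>

lemma omega_bounds: "cpar a / lam a s \<le> omega a s" "omega a s \<le> 1 + cpar a / lam a s"
proof -
  have z: "0 < zfun a s" "zfun a s \<le> 1" and l: "0 < lam a s"
    using zfun_pos zfun_le_1 lam_pos by auto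
  show "cpar a / lam a s \<le> omega a s"
    unfolding omega_def using z l cpar_pos
    by (intro divide_left_mono) (auto simp: mult_left_le_one_le)
  have "omega a s = cpar a * (lam a s + (zfun a s)\<^sup>2) / (zfun a s * lam a s)"
    unfolding lam_plus_zfun_sq omega_def by simp
  also have "\<dots> = cpar a / zfun a s + cpar a * zfun a s / lam a s"
    using z l by (simp add: field_simps power2_eq_square)
  also have "\<dots> \<le> 1 + cpar a / lam a s"
    using z l cpar_pos cpar_le_zfun[of s]
    by (intro add_mono divide_right_mono) (auto simp: mult_left_le)
  finally show "omega a s \<le> 1 + cpar a / lam a s" .
qed

lemma beta_half_pi_ge: "pi/2 \<le> beta a (pi/2)"
  and beta_half_pi_le: "beta a (pi/2) \<le> pi"
proof -
  define \<theta> where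
    "\<theta> = (\<lambda>s. s + arctan (2 * a * sin (2 * s) / (1 + 2 * cpar a - 2 * a * cos (2 * s))))"
  have d\<theta>: "(\<theta> has_real_derivative cpar a / lam a s) (at s)" for s
    unfolding \<theta>_def by (rule poisson_angle_has_derivative)
  have ends: "\<theta> 0 = 0" "\<theta> (pi/2) = pi/2"
    unfolding \<theta>_def by simp_all
  have "beta a 0 - \<theta> 0 \<le> beta a (pi/2) - \<theta> (pi/2)"
    by (rule DERIV_nonneg_imp_nondecreasing[of 0 "pi/2" "\<lambda>s. beta a s - \<theta> s"])
       (auto intro!: exI derivative_intros beta_has_derivative d\<theta> simp: omega_bounds)
  then show "pi/2 \<le> beta a (pi/2)"
    by (simp add: ends beta_0)
  have "0 + \<theta> 0 - beta a 0 \<le> pi/2 + \<theta> (pi/2) - beta a (pi/2)"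
    by (rule DERIV_nonneg_imp_nondecreasing[of 0 "pi/2" "\<lambda>s. s + \<theta> s - beta a s"])
       (auto intro!: exI derivative_intros beta_has_derivative d\<theta> simp: omega_bounds)
  then show "beta a (pi/2) \<le> pi"
    by (simp add: ends beta_0)
qed

lemma beta_strict_mono: "s < t \<Longrightarrow> beta a s < beta a t"
  by (erule DERIV_pos_imp_increasing)
     (auto simp: omega_def cpar_pos zfun_pos lam_pos intro!: exI beta_has_derivative)

section \<open>The unique zero of the free boundary function\<close>

text \<open>
  Both \<open>y z'\<close> and \<open>z y'\<close> contain a multiple of \<open>S sin \<beta>\<close>; \<open>\<lambda> + z\<^sup>2 = 1\<close> merges the two
  into one. The term with \<open>cos \<beta>\<close> comes from \<open>\<beta>' = \<omega>\<close> alone.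
\<close>

lemma zfun_times_Gfun:
  "zfun a s * Gfun a s
     = - (cpar a * zfun a s * cos (beta a s) + a * sin (2 * s) * sin (beta a s)) / sqrt (lam a s)"
proof -
  define r where "r = sqrt (lam a s)"
  have r: "0 < r" "r * r = lam a s"
    using lam_pos[of s] unfolding r_def by simp_all
  have z: "0 < zfun a s"
    by (rule zfun_pos)
  have "(yfun a has_real_derivative
      a * sin (2 * s) / r * sin (beta a s) + r * (cos (beta a s) * omega a s)) (at s)"
    using DERIV_mult[OF sqrt_lam_has_derivative DERIV_chain2[OF DERIV_sin beta_has_derivative]]
    unfolding yfun_def[abs_def] r_def by (simp add: mult_ac)
  then have y': "deriv (yfun a) s
      = a * sin (2 * s) / r * sin (beta a s) + r * (cos (beta a s) * omega a s)"
    by (rule DERIV_imp_deriv)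
  have z': "deriv (zfun a) s = - (a * sin (2 * s)) / zfun a s"
    using zfun_has_derivative by (rule DERIV_imp_deriv)
  have "zfun a s * Gfun a s
      = - (a * sin (2 * s)) * sin (beta a s) * r
        - (zfun a s)\<^sup>2 * (a * sin (2 * s) / r * sin (beta a s))
        - (zfun a s)\<^sup>2 * (r * (cos (beta a s) * omega a s))"
    unfolding Gfun_def y' z' yfun_def r_def[symmetric] using z
    by (simp add: field_simps power2_eq_square)
  also have "(zfun a s)\<^sup>2 * (r * (cos (beta a s) * omega a s))
      = cpar a * zfun a s * cos (beta a s) / r"
    unfolding omega_def r(2)[symmetric] using z r(1) by (simp add: field_simps power2_eq_square)
  also have "(zfun a s)\<^sup>2 = 1 - r * r"
    using lam_plus_zfun_sq[of s] unfolding r(2) by simp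
  finally show ?thesis
    unfolding r_def[symmetric] using r(1) by (simp add: field_simps)
qed

text \<open>
  The factor \<open>z\<close> is what turns the minimal surface equation for \<open>y\<close> into a derivative
  whose sign is that of \<open>sin \<beta>\<close>. In the computation, \<open>(zG)' = \<lambda>\<^sup>2 sin \<beta> / (\<lambda> sqrt \<lambda>)\<close> appears
  once \<open>S\<^sup>2\<close>, \<open>z\<^sup>2\<close> and \<open>a cos 2s\<close> are expressed through \<open>\<lambda>\<close> and \<open>c\<close>.
\<close>

lemma zfun_times_Gfun_has_derivative:
  "((\<lambda>s. zfun a s * Gfun a s) has_real_derivative yfun a s) (at s)"
proof -
  define r where "r = sqrt (lam a s)"
  define z where "z = zfun a s"
  define S where "S = a * sin (2 * s)"
  define C where "C = a * cos (2 * s)"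
  define c where "c = cpar a"
  define sb cb where "sb = sin (beta a s)" and "cb = cos (beta a s)"
  \<comment> \<open>\<open>H'\<close> is the derivative of the numerator \<open>c z cos \<beta> + S sin \<beta>\<close>.\<close>
  define H' where "H' = (c * z * - (sb * (c / (z * lam a s))) + c * (- S / z) * cb)
      + (S * (cb * (c / (z * lam a s))) + 2 * C * sb)"
  have r: "0 < r" "r * r = lam a s"
    using lam_pos[of s] unfolding r_def by simp_all
  have z: "0 < z"
    unfolding z_def by (rule zfun_pos)
  have dz: "(zfun a has_real_derivative - S / z) (at s)"
    unfolding S_def z_def by (rule zfun_has_derivative)
  have db: "(beta a has_real_derivative c / (z * lam a s)) (at s)"
    using beta_has_derivative[of s] unfolding omega_def c_def z_def .
  have dr: "((\<lambda>s. sqrt (lam a s)) has_real_derivative S / r) (at s)"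
    unfolding S_def r_def by (rule sqrt_lam_has_derivative)
  have dH: "((\<lambda>s. cpar a * zfun a s * cos (beta a s) + a * sin (2 * s) * sin (beta a s))
      has_real_derivative H') (at s)"
    by (rule derivative_eq_intros dz db refl)+
       (simp add: H'_def c_def z_def sb_def cb_def S_def C_def algebra_simps)
  have "((\<lambda>s. - (cpar a * zfun a s * cos (beta a s) + a * sin (2 * s) * sin (beta a s))
        / sqrt (lam a s)) has_real_derivative
      ((- H') * r - (- (c * z * cb + S * sb)) * (S / r)) / (r * r)) (at s)"
    unfolding r_def c_def z_def sb_def cb_def S_def
    by (intro DERIV_divide DERIV_minus dH[unfolded r_def c_def z_def sb_def cb_def S_def]
          dr[unfolded r_def c_def z_def sb_def cb_def S_def])
       (use r(1) in \<open>auto simp: r_def\<close>)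
  moreover have "((- H') * r - (- (c * z * cb + S * sb)) * (S / r)) / (r * r) = r * sb"
  proof -
    have zz: "z * z = 1 - r * r"
      using lam_plus_zfun_sq[of s] unfolding r(2) z_def by (simp add: power2_eq_square)
    have CC: "2 * C = 1 - 2 * (r * r)"
      unfolding r(2) C_def lam_def by simp
    have SS: "S * S = r * r * (z * z) - c * c"
      using lam_times_zfun_sq[of s] unfolding r(2) z_def S_def c_def
      by (simp add: power2_eq_square)
    \<comment> \<open>Multiplying by \<open>\<lambda> = r\<^sup>2\<close> clears the denominators of \<open>H'\<close>; the two cosine terms then
      combine because \<open>1 - \<lambda> = z\<^sup>2\<close>.\<close>
    have H'_r: "H' * (r * r) = sb * (2 * C * (r * r) - c * c) + cb * (S * c * z)"
    proof -
      have "H' * (r * r) * z = (sb * (2 * C * (r * r) - c * c)) * z + cb * (S * c) * (1 - r * r)"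
        unfolding H'_def r(2)[symmetric] using z r(1)
        by (simp add: field_simps)
      also have "\<dots> = (sb * (2 * C * (r * r) - c * c) + cb * (S * c * z)) * z"
        unfolding zz[symmetric] by (simp add: algebra_simps)
      finally show ?thesis
        using z by simp
    qed
    have "((- H') * r - (- (c * z * cb + S * sb)) * (S / r)) * r
        = - (H' * (r * r)) + (c * z * cb + S * sb) * S"
      using r(1) by (simp add: field_simps)
    also have "\<dots> = sb * (c * c + S * S - 2 * C * (r * r))"
      unfolding H'_r by (simp add: algebra_simps)
    also have "\<dots> = sb * (r * r * (r * r))"
      unfolding SS CC zz by (simp add: algebra_simps)
    also have "\<dots> = r * sb * (r * r) * r"
      by simp
    finally have "(- H') * r - (- (c * z * cb + S * sb)) * (S / r) = r * sb * (r * r)"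
      using r(1) by (metis mult_right_cancel less_irrefl)
    then show ?thesis
      using r(1) by simp
  qed
  ultimately show ?thesis
    unfolding zfun_times_Gfun yfun_def r_def sb_def by simp
qed

lemma ex1_Gfun_zero: "\<exists>!s. s \<in> {0<..pi/2} \<and> Gfun a s = 0"
proof -
  define W where "W = (\<lambda>s. zfun a s * Gfun a s)"
  have W_zero: "W s = 0 \<longleftrightarrow> Gfun a s = 0" for s
    using zfun_pos[of s] unfolding W_def by simp
  have dW: "(W has_real_derivative yfun a s) (at s)" for s
    unfolding W_def by (rule zfun_times_Gfun_has_derivative)
  have cW: "continuous_on A W" for A
    by (meson DERIV_continuous_on DERIV_subset dW subset_UNIV)
  have W0: "W 0 < 0"
    unfolding W_def zfun_times_Gfun
    using cpar_pos zfun_pos lam_pos by (simp add: beta_0)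
  have "cos (beta a (pi/2)) \<le> 0"
    using beta_half_pi_ge beta_half_pi_le cos_monotone_0_pi_le[of "pi/2" "beta a (pi/2)"] by simp
  then have "cpar a * zfun a (pi/2) * cos (beta a (pi/2)) \<le> 0"
    using cpar_pos zfun_pos by (intro mult_nonneg_nonpos) (auto simp: less_imp_le)
  then have W1: "0 \<le> W (pi/2)"
    unfolding W_def zfun_times_Gfun using lam_pos[of "pi/2"] by (simp add: divide_nonpos_pos)
  obtain s where s: "0 \<le> s" "s \<le> pi/2" "W s = 0"
    using IVT'[of W 0 0 "pi/2"] W0 W1 cW by auto
  have "s \<noteq> 0"
    using W0 s(3) by auto
  have mono: "W u < W v" if uv: "0 \<le> u" "u < v" "v \<le> pi/2" for u v
  proof (rule DERIV_pos_imp_increasing_open[OF uv(2)])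
    fix t assume t: "u < t" "t < v"
    have "0 < beta a t" "beta a t < pi"
      using beta_strict_mono[of 0 t] beta_strict_mono[of t "pi/2"] beta_half_pi_le uv t
      by (auto simp: beta_0)
    then have "0 < yfun a t"
      unfolding yfun_def using lam_pos[of t] by (simp add: sin_gt_zero)
    then show "\<exists>y. (W has_real_derivative y) (at t) \<and> 0 < y"
      using dW by blast
  qed (rule cW)
  show ?thesis
  proof (rule ex1I[of _ s])
    show "s \<in> {0<..pi/2} \<and> Gfun a s = 0"
      using s \<open>s \<noteq> 0\<close> W_zero by auto
  next
    fix t assume t: "t \<in> {0<..pi/2} \<and> Gfun a t = 0"
    then have "W t = 0"
      using W_zero by simp
    then show "t = s"
      using mono[of s t] mono[of t s] s t by (cases s t rule: linorder_cases) auto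
  qed
qed

lemma s1_mem: "s1 a \<in> {0<..pi/2}" and Gfun_s1: "Gfun a (s1 a) = 0"
  using theI'[OF ex1_Gfun_zero] unfolding s1_def by blast+

section \<open>The contact radius\<close>

lemma zfun_log_deriv:
  "deriv (zfun a) s / zfun a s = - (a * sin (2 * s) / (1/2 + a * cos (2 * s)))"
  unfolding DERIV_imp_deriv[OF zfun_has_derivative] zfun_sq[symmetric]
  by (simp add: power2_eq_square)

text \<open>
  The vanishing of \<open>G\<close> in closed form, \<open>c z cos \<beta> = - S sin \<beta>\<close>, determines \<open>cos\<^sup>2 \<beta>\<close>, and
  hence \<open>x\<^sup>2 = \<lambda> cos\<^sup>2 \<beta>\<close>, as a rational expression in \<open>S\<close> and \<open>z\<close>. It also gives the sign
  of \<open>x\<close>, which squaring loses: \<open>S\<close> and \<open>sin \<beta>\<close> are nonnegative on \<open>[0, \<pi>/2]\<close>, so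
  \<open>cos \<beta> \<le> 0\<close>.
\<close>

lemma cot_Rad:
  shows "0 < Rad a" "Rad a < pi"
    and "cot (Rad a) = - (a * sin (2 * s1 a) / (1/2 + a * cos (2 * s1 a)))"
proof -
  define s where "s = s1 a"
  define S where "S = a * sin (2 * s)"
  define z where "z = zfun a s"
  define l where "l = lam a s"
  define c where "c = cpar a"
  define sb cb where "sb = sin (beta a s)" and "cb = cos (beta a s)"
  define x where "x = xfun a s"
  have s: "0 < s" "s \<le> pi/2"
    using s1_mem unfolding s_def by auto
  have pos: "0 < z" "0 < l" "0 < c"
    unfolding z_def l_def c_def using zfun_pos lam_pos cpar_pos by auto
  have "0 \<le> S"
    unfolding S_def using s a_nonneg by (auto intro!: mult_nonneg_nonneg sin_ge_zero)
  have "0 \<le> beta a s" "beta a s \<le> pi"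
    using strict_mono_less_eq[of "beta a" 0 s] strict_mono_less_eq[of "beta a" s "pi/2"]
      beta_half_pi_le s
    by (auto simp: strict_mono_def beta_strict_mono beta_0)
  then have "0 \<le> sb"
    unfolding sb_def by (rule sin_ge_zero)
  have zero: "c * z * cb = - (S * sb)"
    using zfun_times_Gfun[of s] Gfun_s1 pos
    unfolding s_def[symmetric] z_def c_def cb_def sb_def S_def l_def by simp
  then have "c * z * cb \<le> 0"
    using \<open>0 \<le> S\<close> \<open>0 \<le> sb\<close> by simp
  then have "cb \<le> 0"
    using pos by (simp add: mult_le_0_iff)
  then have "x \<le> 0"
    unfolding x_def xfun_def cb_def using lam_pos[of s] by (intro mult_nonneg_nonpos) auto
  have x2: "x\<^sup>2 = l * cb\<^sup>2"
    unfolding x_def xfun_def l_def cb_def using lam_pos[of s] by (simp add: power_mult_distrib)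
  have lz: "l + z\<^sup>2 = 1" "l * z\<^sup>2 = c\<^sup>2 + S\<^sup>2"
    unfolding l_def z_def c_def S_def by (rule lam_plus_zfun_sq lam_times_zfun_sq)+
  have "(c * z * cb)\<^sup>2 = S\<^sup>2 * (1 - cb\<^sup>2)"
    unfolding zero by (simp add: power_mult_distrib sin_squared_eq sb_def cb_def)
  then have cb2: "cb\<^sup>2 * (c\<^sup>2 * z\<^sup>2 + S\<^sup>2) = S\<^sup>2"
    by (simp add: power_mult_distrib algebra_simps)
  have "c\<^sup>2 * z\<^sup>2 + S\<^sup>2 = l * ((z\<^sup>2)\<^sup>2 + S\<^sup>2)"
  proof -
    have l: "l = 1 - z\<^sup>2" using lz(1) by simp
    have S2: "S\<^sup>2 = l * z\<^sup>2 - c\<^sup>2" using lz(2) by simp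
    show ?thesis
      unfolding S2 l by (simp add: algebra_simps power2_eq_square)
  qed
  \<comment> \<open>Equivalently \<open>x\<^sup>2 = m\<^sup>2 (1 - x\<^sup>2)\<close> for \<open>m = - S/z\<^sup>2\<close>, the logarithmic derivative of \<open>z\<close>.\<close>
  then have key: "x\<^sup>2 * ((z\<^sup>2)\<^sup>2 + S\<^sup>2) = S\<^sup>2"
    using cb2 unfolding x2 by (simp add: mult_ac)
  have x_less: "x\<^sup>2 < 1"
  proof (rule ccontr)
    assume "\<not> x\<^sup>2 < 1"
    then have "1 * ((z\<^sup>2)\<^sup>2 + S\<^sup>2) \<le> x\<^sup>2 * ((z\<^sup>2)\<^sup>2 + S\<^sup>2)"
      by (intro mult_right_mono) auto
    then show False
      using key pos by (simp add: not_less[symmetric])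
  qed
  then have x_abs: "\<bar>x\<bar> < 1"
    by (simp add: abs_square_less_1)
  have R: "Rad a = arccos x"
    unfolding Rad_def x_def s_def ..
  show "0 < Rad a" "Rad a < pi"
    unfolding R using x_abs arccos_lt_bounded[of x] by auto
  have "(- x)\<^sup>2 * (z\<^sup>2)\<^sup>2 = S\<^sup>2 * (1 - x\<^sup>2)"
    using key by (simp add: algebra_simps)
  then have "((- x) * z\<^sup>2)\<^sup>2 = (S * sqrt (1 - x\<^sup>2))\<^sup>2"
    using x_less by (simp add: power_mult_distrib)
  then have "(- x) * z\<^sup>2 = S * sqrt (1 - x\<^sup>2)"
    by (rule power2_eq_imp_eq)
       (use \<open>x \<le> 0\<close> \<open>0 \<le> S\<close> x_less in \<open>auto intro: mult_nonpos_nonneg\<close>)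
  then have "x / sqrt (1 - x\<^sup>2) = - (S / z\<^sup>2)"
    using pos x_less by (simp add: field_simps)
  then show "cot (Rad a) = - (a * sin (2 * s1 a) / (1/2 + a * cos (2 * s1 a)))"
    unfolding R cot_def using x_abs
    by (simp add: sin_arccos_abs cos_arccos_abs S_def z_def zfun_sq s_def)
qed

end

lemma eq_half_pi_minus_arctan_cot:
  assumes "0 < R" "R < pi"
  shows "R = pi/2 - arctan (cot R)"
proof -
  have "arctan (tan (pi/2 - R)) = pi/2 - R"
    using assms by (intro arctan_tan) auto
  then show ?thesis
    by (simp add: tan_cot')
qed

text \<open>
  The subtraction from \<open>0\<close> stands for a sign change, which is not among the rules of
  \<open>elementary_on\<close>. The only side condition, \<open>1/2 + a cos 2s \<noteq> 0\<close>, is the positivity of \<open>z\<^sup>2\<close>.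
\<close>

lemma elementary_contact_radius:
  "elementary_on ({0..<1/2} \<times> {0<..pi/2})
     (\<lambda>p. pi/2 - arctan (0 - fst p * sin (2 * snd p) / (1/2 + fst p * cos (2 * snd p))))"
  using zfun_arg_pos
  by (intro elementary_on.intros) (auto simp: less_le)

theorem proposition5p8:
  shows "(\<forall>a\<in>{0..<1/2 :: real}.
           cot (Rad a) = deriv (zfun a) (s1 a) / zfun a (s1 a)
         \<and> deriv (zfun a) (s1 a) / zfun a (s1 a)
             = - (a * sin (2 * s1 a) / (1/2 + a * cos (2 * s1 a))))
       \<and> (\<exists>F. elementary_on ({0..<1/2} \<times> {0<..pi/2}) F
             \<and> (\<forall>a\<in>{0..<1/2 :: real}. Rad a = F (a, s1 a)))"
proof (intro conjI exI ballI)
  fix a :: real assume "a \<in> {0..<1/2}"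
  then have a: "0 \<le> a" "a < 1/2" by auto
  show "deriv (zfun a) (s1 a) / zfun a (s1 a)
      = - (a * sin (2 * s1 a) / (1/2 + a * cos (2 * s1 a)))"
    by (rule zfun_log_deriv[OF a])
  then show "cot (Rad a) = deriv (zfun a) (s1 a) / zfun a (s1 a)"
    using cot_Rad(3)[OF a] by simp
  show "Rad a = (\<lambda>p. pi/2 - arctan
      (0 - fst p * sin (2 * snd p) / (1/2 + fst p * cos (2 * snd p)))) (a, s1 a)"
    using eq_half_pi_minus_arctan_cot[OF cot_Rad(1,2)[OF a]] cot_Rad(3)[OF a] by simp
qed (rule elementary_contact_radius)

end
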